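(* Let $\beta>0$ and $T>0$, and suppose the (continuous) boundary forcing functions $f_1,f_n:\mathbb R\to\mathbb R^p$ are $T$-periodic, $f_1(t+T)=f_1(t)$ and $f_n(t+T)=f_n(t)$. Consider the semi-discrete hyperbolic curvature flow $\ddot{\vec U}+\beta\dot{\vec U}=A\vec U+f_1(t)e_1+f_n(t)e_n$. Then: (i) There exists a unique $T$-periodic solution $\vec U^*(t)$. (ii) This solution is globally asymptotically stable: for any other solution $\vec U(t)$, $$\lim_{t\to\infty}\|\vec U(t)-\vec U^*(t)\|=0 .$$
   Context: Fix integers $n\ge4$, $p\ge2$. $\vec U=(X_2,\dots,X_{n-1})^\top$ is the $(n-2)\times p$ matrix of interior points of a piecewise linear curve $X_1,\dots,X_n\in\mathbb R^p$ whose end points are prescribed by $X_1=f_1(t)$, $X_n=f_n(t)$. $A=\mathrm{tridiag}(1,-2,1)$ is the $(n-2)\times(n-2)$ tridiagonal matrix with diagonal entries $-2$ and sub-/superdiagonal entries $1$. $f_1(t)e_1+f_n(t)e_n$ is the $(n-2)\times p$ matrix with first row $f_1(t)$, last row $f_n(t)$ and other rows zero. *)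

theory Defs
  imports "HOL-Analysis.Analysis"
begin

text \<open>
  The interior points \<open>X\<^sub>2, \<dots>, X\<^sub>n\<^sub>-\<^sub>1\<close> of the curve are the rows of a matrix
  of type \<open>real^'p^'m\<close>. The row index \<open>'m\<close> is an arbitrary finite linearly ordered type,
  and the row with \<open>position\<close> \<open>k\<close> (counted from 0) is \<open>X\<^sub>k\<^sub>+\<^sub>2\<close>.
\<close>

definition position :: "'m::{finite,linorder} \<Rightarrow> nat" where
  "position i = card {k. k < i}"

text \<open>Arguments in the order sub-diagonal, diagonal, super-diagonal.\<close>

definition tridiag :: "real \<Rightarrow> real \<Rightarrow> real \<Rightarrow> real^('m::{finite,linorder})^('m::{finite,linorder})" where
  "tridiag a b c = (\<chi> i j.
     if position i = Suc (position j) then a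
     else if position i = position j then b
     else if position j = Suc (position i) then c
     else 0)"

text \<open>
  \<open>axis i v\<close> is the matrix with row \<open>i\<close> equal to \<open>v\<close> and all other rows zero.
\<close>

definition boundary_forcing ::
  "real^'p \<Rightarrow> real^'p \<Rightarrow> real^'p^('m::{finite,linorder})" where
  "boundary_forcing v w = axis (Min UNIV) v + axis (Max UNIV) w"

text \<open>
  Classical solutions of \<open>U'' + \<beta> U' = A U + f\<^sub>1(t) e\<^sub>1 + f\<^sub>n(t) e\<^sub>n\<close> on a time
  interval \<open>S\<close>; at an end point of \<open>S\<close> the derivatives are one-sided.
\<close>

definition hcf_solution_on ::
  "real set \<Rightarrow> real \<Rightarrow> (real \<Rightarrow> real^'p) \<Rightarrow> (real \<Rightarrow> real^'p) \<Rightarrow>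
   (real \<Rightarrow> real^'p^('m::{finite,linorder})) \<Rightarrow> bool" where
  "hcf_solution_on S \<beta> f1 fn U \<longleftrightarrow>
     (\<exists>U' U''. \<forall>t\<in>S.
        (U has_vector_derivative U' t) (at t within S) \<and>
        (U' has_vector_derivative U'' t) (at t within S) \<and>
        U'' t + \<beta> *\<^sub>R U' t =
          tridiag 1 (-2) 1 ** U t + boundary_forcing (f1 t) (fn t))"

end

theory Submission
  imports Defs
begin

text \<open>
  The matrix \<open>A = tridiag(1,-2,1)\<close> is the discrete Laplacian with zero boundary values. Acting on
  the space of interior points it is self-adjoint, and summation by parts shows that
  \<open>U \<bullet> A U\<close> is minus a sum of squared increments that vanishes only for \<open>U = 0\<close>. By the
  spectral theorem there is an orthonormal basis of eigenvectors \<open>b\<close> with \<open>A b = - l b\<close> and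
  \<open>l > 0\<close>, and in its coordinates the flow decouples into scalar damped oscillators
  \<open>u'' + \<beta> u' + l u = h\<close>.

  A single oscillator has a periodic response to a periodic force: over the complex numbers
  \<open>D\<^sup>2 + \<beta> D + l = (D - r\<^sub>2) (D - r\<^sub>1)\<close>, where both roots have negative real part, and each first
  order factor can be inverted on periodic functions
  (\<open>first_order_periodic_solution\<close>, \<open>damped_oscillator_periodic_solution\<close>). This argument covers
  the overdamped, critical and oscillating cases at once. Without force the
  oscillator decays exponentially, because a suitably modified energy is a strict Lyapunov
  function (\<open>damped_oscillator_decay\<close>).

  Summing over the eigenbasis gives a periodic solution of the flow, and the difference of any two
  solutions tends to zero, which is the stability claim. Two periodic solutions have a periodic
  difference; as this tends to zero, it is zero.

  Everything up to the definiteness of \<open>A\<close> is done for an arbitrary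
  self-adjoint, negative definite operator on a Euclidean space.
\<close>

section \<open>Orthonormal eigenbases of self-adjoint operators\<close>

lemma quadratic_nonneg_linear_term_zero:
  fixes a b :: real
  assumes "\<And>t. 0 \<le> 2 * t * a + t\<^sup>2 * b"
  shows "a = 0"
proof (rule ccontr)
  assume "a \<noteq> 0"
  \<comment> \<open>Test at \<open>t = - a / c\<close>, the minimiser after replacing \<open>b\<close> by a positive upper bound \<open>c\<close>.\<close>
  define c where "c = \<bar>b\<bar> + 1"
  have c: "c > 0" "b \<le> c" by (auto simp: c_def)
  have "0 \<le> 2 * (- a / c) * a + (- a / c)\<^sup>2 * b" by (rule assms)
  also have "\<dots> \<le> 2 * (- a / c) * a + (- a / c)\<^sup>2 * c"
    using c by (intro add_left_mono mult_left_mono) auto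
  also have "\<dots> = - (a\<^sup>2 / c)"
    using c by (simp add: power2_eq_square field_simps)
  also have "\<dots> < 0"
    using c \<open>a \<noteq> 0\<close> by simp
  finally show False by simp
qed

text \<open>
  A maximiser \<open>x\<close> of the Rayleigh quotient on \<open>W\<close> is an eigenvector: with the maximum \<open>\<mu>\<close>, the
  form \<open>\<mu> (z \<bullet> z) - z \<bullet> L z\<close> is nonnegative on \<open>W\<close> and vanishes at \<open>x\<close>, so its derivative at
  \<open>x\<close> vanishes in the direction \<open>\<mu> x - L x\<close>, and this derivative is twice the squared norm
  of that direction.
\<close>

lemma self_adjoint_eigenvector_in_invariant_subspace:
  fixes L :: "'a::euclidean_space \<Rightarrow> 'a"
  assumes L: "linear L" and sym: "\<And>x y. L x \<bullet> y = x \<bullet> L y"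
    and W: "subspace W" "\<And>x. x \<in> W \<Longrightarrow> L x \<in> W" "a \<in> W" "a \<noteq> 0"
  obtains x \<mu> where "x \<in> W" "norm x = 1" "L x = \<mu> *\<^sub>R x"
proof -
  let ?S = "W \<inter> sphere 0 1"
  have "compact ?S"
    using W(1) by (intro closed_Int_compact closed_subspace) auto
  moreover have "(1 / norm a) *\<^sub>R a \<in> ?S"
    using W by (auto simp: subspace_scale)
  moreover have "continuous_on ?S (\<lambda>x. x \<bullet> L x)"
    using L by (intro continuous_intros linear_continuous_on linear_linear[THEN iffD2])
      (auto simp: linear_conv_bounded_linear)
  ultimately obtain x where x: "x \<in> ?S" and max: "\<And>y. y \<in> ?S \<Longrightarrow> y \<bullet> L y \<le> x \<bullet> L x"
    using continuous_attains_sup[of ?S "\<lambda>x. x \<bullet> L x"] by blast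
  define \<mu> where "\<mu> = x \<bullet> L x"
  have bound: "y \<bullet> L y \<le> \<mu> * (y \<bullet> y)" if "y \<in> W" for y
  proof (cases "y = 0")
    case False
    have "(1 / norm y) *\<^sub>R y \<in> ?S"
      using that W(1) False by (auto simp: subspace_scale)
    from max[OF this] have "(y \<bullet> L y) / (norm y)\<^sup>2 \<le> \<mu>"
      using L by (simp add: linear_cmul \<mu>_def power2_eq_square)
    then show ?thesis
      using False by (simp add: divide_le_eq dot_square_norm)
  qed simp
  \<comment> \<open>The defect of the eigenvalue equation serves as the direction of variation.\<close>
  define y where "y = \<mu> *\<^sub>R x - L x"
  have yW: "y \<in> W" unfolding y_def using x W by (auto intro: subspace_diff subspace_scale)
  have xx: "x \<bullet> x = 1" using x by (simp add: dot_square_norm)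
  have "0 \<le> 2 * t * (y \<bullet> y) + t\<^sup>2 * (\<mu> * (y \<bullet> y) - y \<bullet> L y)" for t
  proof -
    have "x + t *\<^sub>R y \<in> W" using x yW W(1) by (auto intro: subspace_add subspace_scale)
    from bound[OF this] have "0 \<le> \<mu> * ((x + t *\<^sub>R y) \<bullet> (x + t *\<^sub>R y)) - (x + t *\<^sub>R y) \<bullet> L (x + t *\<^sub>R y)"
      by simp
    also have "\<dots> = (\<mu> * (x \<bullet> x) - x \<bullet> L x) + 2 * t * (\<mu> * (x \<bullet> y) - L x \<bullet> y)
        + t\<^sup>2 * (\<mu> * (y \<bullet> y) - y \<bullet> L y)"
      using sym[of x y] sym[of y x]
      by (simp add: linear_add[OF L] linear_cmul[OF L] inner_commute power2_eq_square algebra_simps)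
    also have "\<mu> * (x \<bullet> x) - x \<bullet> L x = 0" by (simp add: xx \<mu>_def)
    also have "\<mu> * (x \<bullet> y) - L x \<bullet> y = (\<mu> *\<^sub>R x - L x) \<bullet> y"
      by (simp add: inner_diff_left)
    also have "\<dots> = y \<bullet> y" by (simp only: y_def)
    finally show ?thesis by simp
  qed
  then have "y \<bullet> y = 0" by (rule quadratic_nonneg_linear_term_zero)
  then have "L x = \<mu> *\<^sub>R x" by (simp add: y_def)
  with x show thesis using that by auto
qed

text \<open>
  An orthonormal set of eigenvectors of maximal cardinality spans the space: its orthogonal
  complement is invariant under \<open>L\<close>, so a nonzero complement would contain a further eigenvector.
\<close>

lemma self_adjoint_orthonormal_eigenbasis:
  fixes L :: "'a::euclidean_space \<Rightarrow> 'a"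
  assumes L: "linear L" and sym: "\<And>x y. L x \<bullet> y = x \<bullet> L y"
  obtains B m where "finite B" "pairwise orthogonal B" "\<And>b. b \<in> B \<Longrightarrow> norm b = 1"
    "span B = UNIV" "\<And>b. b \<in> B \<Longrightarrow> L b = m b *\<^sub>R b"
proof -
  define P where "P B \<longleftrightarrow> pairwise orthogonal B \<and> (\<forall>b\<in>B. norm b = 1 \<and> (\<exists>\<mu>. L b = \<mu> *\<^sub>R b))"
    for B :: "'a set"
  have P_bound: "finite B \<and> card B \<le> DIM('a)" if "P B" for B
    using that unfolding P_def
    by (intro independent_bound pairwise_orthogonal_independent) auto
  have "P {}" by (simp add: P_def)
  then obtain B where B: "P B" and max: "\<And>C. P C \<Longrightarrow> card C \<le> card B"
    using ex_has_greatest_nat[of P "{}" card "Suc DIM('a)"] P_bound by (auto simp: less_Suc_eq_le)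
  have "span B = UNIV"
  proof (rule ccontr)
    assume "span B \<noteq> UNIV"
    then obtain a where a: "a \<noteq> 0" "\<And>x. x \<in> span B \<Longrightarrow> a \<bullet> x = 0"
      using span_not_UNIV_orthogonal by blast
    define W where "W = {x. \<forall>b\<in>B. b \<bullet> x = 0}"
    have "subspace W"
      by (auto simp: W_def subspace_def inner_add_right)
    moreover have "L x \<in> W" if "x \<in> W" for x
    proof -
      have "b \<bullet> L x = 0" if "b \<in> B" for b
      proof -
        have "\<exists>\<mu>. L b = \<mu> *\<^sub>R b" using B that by (simp add: P_def)
        then obtain \<mu> where "L b = \<mu> *\<^sub>R b" ..
        then show ?thesis using sym[of b x] \<open>x \<in> W\<close> that by (simp add: W_def)
      qed
      then show ?thesis by (simp add: W_def)
    qed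
    moreover have "a \<in> W" using a(2) by (auto simp: W_def span_base inner_commute)
    ultimately obtain x \<mu> where x: "x \<in> W" "norm x = 1" "L x = \<mu> *\<^sub>R x"
      using self_adjoint_eigenvector_in_invariant_subspace[OF L sym] a(1) by blast
    have "x \<notin> B" using x by (auto simp: W_def)
    moreover have "P (insert x B)"
      using B x by (auto simp: P_def W_def pairwise_insert orthogonal_def inner_commute)
    then have "card (insert x B) \<le> card B" by (rule max)
    ultimately show False using P_bound[OF B] by simp
  qed
  moreover obtain m where "\<And>b. b \<in> B \<Longrightarrow> L b = m b *\<^sub>R b"
    using B unfolding P_def by metis
  ultimately show thesis using that[of B m] B P_bound[OF B] by (simp add: P_def)
qed

section \<open>The scalar damped oscillator\<close>

text \<open>
  Variation of constants gives the solutions \<open>w t = exp (r t) (c + G t)\<close> with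
  \<open>G' t = exp (- r t) h t\<close>. Since \<open>exp (r T) \<noteq> 1\<close>, the constant \<open>c\<close> can be chosen such that
  \<open>w T = w 0\<close>. Then \<open>w (t + T)\<close> and \<open>w t\<close> solve the same equation with the same value at
  \<open>0\<close>, so they agree.
\<close>

lemma first_order_periodic_solution:
  fixes r :: complex and h :: "real \<Rightarrow> complex"
  assumes r: "Re r < 0" and T: "T > 0"
    and cont: "continuous_on UNIV h" and per: "\<And>t. h (t + T) = h t"
  obtains w where "\<And>t. (w has_vector_derivative r * w t + h t) (at t)" "\<And>t. w (t + T) = w t"
proof -
  have "\<And>t. isCont (\<lambda>s. exp (s *\<^sub>R (- r)) * h s) t"
    using cont by (intro continuous_intros) (auto simp: continuous_on_eq_continuous_at)
  then obtain G where G: "\<And>t. (G has_vector_derivative exp (t *\<^sub>R (- r)) * h t) (at t)"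
    using einterval_antiderivative[of "-\<infinity>" "\<infinity>" "\<lambda>s. exp (s *\<^sub>R (- r)) * h s"] by auto
  have "norm (exp (T *\<^sub>R r)) < 1"
    using r T by (simp add: mult_pos_neg)
  then have ne: "exp (T *\<^sub>R r) \<noteq> 1" by (metis less_irrefl norm_one)
  define c where "c = (exp (T *\<^sub>R r) * G T - G 0) / (1 - exp (T *\<^sub>R r))"
  define w where "w t = exp (t *\<^sub>R r) * (c + G t)" for t
  have inv: "exp (t *\<^sub>R r) * exp (t *\<^sub>R (- r)) = 1" for t
    by (simp add: exp_minus)
  have w: "(w has_vector_derivative r * w t + h t) (at t)" for t
  proof -
    have "(w has_vector_derivative
        exp (t *\<^sub>R r) * (0 + exp (t *\<^sub>R (- r)) * h t) + r * exp (t *\<^sub>R r) * (c + G t)) (at t)"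
      unfolding w_def
      by (intro has_vector_derivative_mult has_vector_derivative_add has_vector_derivative_const
          exp_scaleR_has_vector_derivative_left G)
    also have "exp (t *\<^sub>R r) * (0 + exp (t *\<^sub>R (- r)) * h t) = h t"
      using inv[of t] by (simp add: mult.assoc[symmetric])
    finally show ?thesis by (simp add: w_def[abs_def] add.commute mult.assoc)
  qed
  have w0: "w T = w 0"
    using ne by (simp add: w_def c_def field_simps)
  \<comment> \<open>Periodicity of \<open>w\<close>: the integrating factor makes the difference of the two solutions constant.\<close>
  define z where "z t = exp (t *\<^sub>R (- r)) * (w (t + T) - w t)" for t
  have "(z has_vector_derivative 0) (at t)" for t
  proof -
    have shift: "((\<lambda>t. w (t + T)) has_vector_derivative r * w (t + T) + h (t + T)) (at t)"
    proof -
      have "((\<lambda>t. t + T) has_vector_derivative 1) (at t)"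
        by (auto intro!: derivative_eq_intros)
      from vector_diff_chain_at[OF this w] show ?thesis by (simp add: o_def)
    qed
    have "(z has_vector_derivative exp (t *\<^sub>R (- r)) * ((r * w (t + T) + h (t + T)) - (r * w t + h t))
        + (- r) * exp (t *\<^sub>R (- r)) * (w (t + T) - w t)) (at t)"
      unfolding z_def
      by (intro has_vector_derivative_mult has_vector_derivative_diff shift w
          exp_scaleR_has_vector_derivative_left)
    then show ?thesis unfolding per by (simp add: algebra_simps)
  qed
  then obtain k where k: "\<And>t. z t = k"
    using has_derivative_zero_constant[of UNIV z] by (auto simp: has_vector_derivative_def)
  from k[of 0] have "k = 0" by (simp add: z_def w0)
  then have "w (t + T) = w t" for t
    using k[of t] by (simp add: z_def)
  with w show thesis by (rule that)
qed

text \<open>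
  If \<open>r\<close> is not real, the imaginary part of the equation forces \<open>Re r = - \<beta> / 2\<close>; if \<open>r\<close> is
  real and nonnegative, all terms of the equation are nonnegative and \<open>l\<close> is positive.
\<close>

lemma damped_characteristic_root_Re_neg:
  fixes r :: complex
  assumes "\<beta> > 0" "l > 0" and root: "r\<^sup>2 + of_real \<beta> * r + of_real l = 0"
  shows "Re r < 0"
proof -
  have im: "Im r * (2 * Re r + \<beta>) = 0"
    using arg_cong[OF root, of Im] by (simp add: power2_eq_square algebra_simps)
  have re: "(Re r)\<^sup>2 - (Im r)\<^sup>2 + \<beta> * Re r + l = 0"
    using arg_cong[OF root, of Re] by (simp add: power2_eq_square algebra_simps)
  show ?thesis
  proof (cases "Im r = 0")
    case True
    show ?thesis
    proof (rule ccontr)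
      assume "\<not> ?thesis"
      then have "(Re r)\<^sup>2 + \<beta> * Re r + l > 0" using assms(1,2) by (intro add_nonneg_pos) auto
      with re True show False by simp
    qed
  next
    case False
    with im assms(1) show ?thesis by simp
  qed
qed

text \<open>
  Invert the two factors of \<open>(D - r1) (D - r2)\<close> one after the other on periodic functions and take
  the real part of the result.
\<close>

lemma damped_oscillator_periodic_solution:
  fixes h :: "real \<Rightarrow> real"
  assumes \<beta>: "\<beta> > 0" and l: "l > 0" and T: "T > 0"
    and cont: "continuous_on UNIV h" and per: "\<And>t. h (t + T) = h t"
  obtains u v where "\<And>t. (u has_vector_derivative v t) (at t)"
    "\<And>t. (v has_vector_derivative h t - \<beta> * v t - l * u t) (at t)" "\<And>t. u (t + T) = u t"
proof -
  define s where "s = csqrt (of_real (\<beta>\<^sup>2 / 4 - l))"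
  define r1 where "r1 = - of_real (\<beta> / 2) + s"
  define r2 where "r2 = - of_real (\<beta> / 2) - s"
  have s2: "s\<^sup>2 = of_real (\<beta>\<^sup>2 / 4 - l)" by (simp add: s_def)
  have sum: "r1 + r2 = - of_real \<beta>" by (simp add: r1_def r2_def flip: of_real_add)
  have prod: "r1 * r2 = of_real l"
  proof -
    have "r1 * r2 = of_real (\<beta>\<^sup>2 / 4) - s\<^sup>2"
      by (simp add: r1_def r2_def power2_eq_square algebra_simps)
    then show ?thesis by (simp add: s2)
  qed
  have "r\<^sup>2 + of_real \<beta> * r + of_real l = (r - r1) * (r - r2)" for r
  proof -
    have "(r - r1) * (r - r2) = r\<^sup>2 - (r1 + r2) * r + r1 * r2"
      by (simp add: power2_eq_square algebra_simps)
    then show ?thesis by (simp add: sum prod)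
  qed
  then have Re: "Re r1 < 0" "Re r2 < 0"
    using damped_characteristic_root_Re_neg[OF \<beta> l] by simp_all
  have "continuous_on UNIV (\<lambda>t. complex_of_real (h t))"
    using cont by (intro continuous_intros)
  then obtain w where w: "\<And>t. (w has_vector_derivative r1 * w t + of_real (h t)) (at t)"
      "\<And>t. w (t + T) = w t"
    using first_order_periodic_solution[OF Re(1) T, of "\<lambda>t. of_real (h t)"] per by metis
  then have "continuous_on UNIV w"
    using continuous_on_vector_derivative[of UNIV w "\<lambda>t. r1 * w t + of_real (h t)"] by simp
  then obtain y where y: "\<And>t. (y has_vector_derivative r2 * y t + w t) (at t)"
      "\<And>t. y (t + T) = y t"
    using first_order_periodic_solution[OF Re(2) T, of w] w(2) by blast
  \<comment> \<open>The derivative of \<open>y\<close> is \<open>r2 y + w\<close>; eliminating \<open>w\<close> leaves the second order equation.\<close>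
  have y2: "((\<lambda>t. r2 * y t + w t) has_vector_derivative
      of_real (h t) - of_real \<beta> * (r2 * y t + w t) - of_real l * y t) (at t)" for t
  proof -
    have "((\<lambda>t. r2 * y t + w t) has_vector_derivative
        r2 * (r2 * y t + w t) + (r1 * w t + of_real (h t))) (at t)"
      by (intro has_vector_derivative_add has_vector_derivative_mult_right y w)
    also have "r2 * (r2 * y t + w t) + (r1 * w t + of_real (h t))
        = of_real (h t) + (r1 + r2) * (r2 * y t + w t) - (r1 * r2) * y t"
      by (simp add: algebra_simps)
    finally show ?thesis by (simp add: sum prod)
  qed
  show thesis
  proof (rule that)
    show "((\<lambda>t. Re (y t)) has_vector_derivative Re (r2 * y t + w t)) (at t)" for t
      using bounded_linear.has_vector_derivative[OF bounded_linear_Re y(1)] .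
    show "((\<lambda>t. Re (r2 * y t + w t)) has_vector_derivative
        h t - \<beta> * Re (r2 * y t + w t) - l * Re (y t)) (at t)" for t
      using bounded_linear.has_vector_derivative[OF bounded_linear_Re y2] by simp
    show "Re (y (t + T)) = Re (y t)" for t by (simp add: y(2))
  qed
qed

text \<open>
  The energy \<open>(v\<^sup>2 + l d\<^sup>2) / 2\<close> itself only has derivative \<open>- \<beta> v\<^sup>2\<close>, which gives no control
  at the turning points \<open>v = 0\<close>. The mixed term in \<open>F\<close> below repairs this: along solutions
  \<open>F' = - \<beta> (v\<^sup>2 + l d\<^sup>2)\<close>, and the right-hand side is at most \<open>- (\<beta> / C) F\<close>. Hence \<open>F\<close>
  decays like \<open>exp (- (\<beta> / C) t)\<close>, and \<open>F\<close> dominates \<open>l d\<^sup>2\<close>.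
\<close>

lemma damped_oscillator_decay:
  fixes d v :: "real \<Rightarrow> real"
  assumes \<beta>: "\<beta> > 0" and l: "l > 0"
    and d: "\<And>t. t \<ge> t0 \<Longrightarrow> (d has_vector_derivative v t) (at t within {t0..})"
    and v: "\<And>t. t \<ge> t0 \<Longrightarrow> (v has_vector_derivative - \<beta> * v t - l * d t) (at t within {t0..})"
  shows "(d \<longlongrightarrow> 0) at_top"
proof -
  define F where "F t = (v t + \<beta> / 2 * d t)\<^sup>2 + (l + \<beta>\<^sup>2 / 4) * (d t)\<^sup>2" for t
  \<comment> \<open>Large enough that completing a square absorbs the mixed term \<open>\<beta> v d\<close> of \<open>F\<close>.\<close>
  define C where "C = 2 + \<beta>\<^sup>2 / l"
  have C: "C > 0" using l by (auto simp: C_def intro: add_pos_nonneg)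
  have F_le: "F t \<le> C * ((v t)\<^sup>2 + l * (d t)\<^sup>2)" for t
  proof -
    have "C * ((v t)\<^sup>2 + l * (d t)\<^sup>2) - F t
        = (v t - \<beta> * d t)\<^sup>2 / 2 + (v t)\<^sup>2 / 2 + l * (d t)\<^sup>2 + (v t)\<^sup>2 * (\<beta>\<^sup>2 / l)"
      using l by (simp add: F_def C_def power2_eq_square field_simps)
    also have "\<dots> \<ge> 0" using l by simp
    finally show ?thesis by simp
  qed
  \<comment> \<open>Gronwall: \<open>F' \<le> - (\<beta> / C) F\<close> makes \<open>E\<close> nonincreasing.\<close>
  define E where "E t = exp (\<beta> / C * t) * F t" for t
  have E_deriv: "(E has_vector_derivative
      exp (\<beta> / C * t) * (\<beta> / C * F t - \<beta> * ((v t)\<^sup>2 + l * (d t)\<^sup>2))) (at t within {t0..})"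
    if "t \<ge> t0" for t
    unfolding has_real_derivative_iff_has_vector_derivative[symmetric] E_def F_def
    using d[OF that] v[OF that] C
    unfolding has_real_derivative_iff_has_vector_derivative[symmetric]
    by (auto intro!: derivative_eq_intros simp: power2_eq_square algebra_simps)
  have E_le: "E t \<le> E t0" if "t \<ge> t0" for t
  proof (rule DERIV_nonpos_imp_decreasing_open[OF that])
    fix x assume x: "t0 < x" "x < t"
    have "at x within {t0..} = at x" using x by (intro at_within_interior) auto
    then have "DERIV E x :> exp (\<beta> / C * x) * (\<beta> / C * F x - \<beta> * ((v x)\<^sup>2 + l * (d x)\<^sup>2))"
      using E_deriv[of x] x by (simp add: has_real_derivative_iff_has_vector_derivative)
    moreover have "\<beta> / C * F x \<le> \<beta> * ((v x)\<^sup>2 + l * (d x)\<^sup>2)"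
    proof -
      have "F x / C \<le> (v x)\<^sup>2 + l * (d x)\<^sup>2"
        using F_le[of x] C by (simp add: divide_le_eq mult.commute)
      from mult_left_mono[OF this, of \<beta>] show ?thesis using \<beta> by simp
    qed
    ultimately show "\<exists>y. DERIV E x :> y \<and> y \<le> 0"
      by (intro exI[of _ "exp (\<beta> / C * x) * (\<beta> / C * F x - \<beta> * ((v x)\<^sup>2 + l * (d x)\<^sup>2))"])
        (simp add: mult_le_0_iff)
  next
    have "continuous_on {t0..} E"
      using E_deriv by (intro continuous_on_vector_derivative) auto
    then show "continuous_on {t0..t} E" by (rule continuous_on_subset) auto
  qed
  have bound: "(d t)\<^sup>2 \<le> E t0 / l * exp (- (\<beta> / C) * t)" if "t \<ge> t0" for t
  proof -
    have "l * (d t)\<^sup>2 \<le> F t"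
      by (simp add: F_def distrib_right)
    also have "F t = exp (- (\<beta> / C) * t) * E t"
      by (simp add: E_def exp_minus)
    also have "\<dots> \<le> exp (- (\<beta> / C) * t) * E t0"
      using E_le[OF that] by simp
    finally show ?thesis using l by (simp add: field_simps)
  qed
  have "((\<lambda>t. exp (- (\<beta> / C) * t)) \<longlongrightarrow> 0) at_top"
    using \<beta> C
    by (intro filterlim_compose[OF exp_at_bot]
        filterlim_tendsto_neg_mult_at_bot[OF tendsto_const _ filterlim_ident]) auto
  then have lim: "((\<lambda>t. E t0 / l * exp (- (\<beta> / C) * t)) \<longlongrightarrow> 0) at_top"
    by (rule tendsto_mult_right_zero)
  have "\<forall>\<^sub>F t in at_top. (d t)\<^sup>2 \<le> E t0 / l * exp (- (\<beta> / C) * t)"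
    using eventually_ge_at_top[of t0] by (rule eventually_mono) (rule bound)
  then have "((\<lambda>t. (d t)\<^sup>2) \<longlongrightarrow> 0) at_top"
    by (rule tendsto_sandwich[OF always_eventually _ tendsto_const lim, rotated]) simp
  then show ?thesis by simp
qed

section \<open>The damped wave equation for a negative definite operator\<close>

text \<open>
  This contains \<open>hcf_solution_on\<close> as the case where \<open>L\<close> is multiplication by the tridiagonal matrix
  and \<open>g\<close> is the boundary forcing.
\<close>

definition damped_wave_solution_on ::
  "real set \<Rightarrow> real \<Rightarrow> ('a \<Rightarrow> 'a) \<Rightarrow> (real \<Rightarrow> 'a) \<Rightarrow> (real \<Rightarrow> 'a::real_normed_vector) \<Rightarrow> bool" where
  "damped_wave_solution_on S \<beta> L g U \<longleftrightarrow>
     (\<exists>U' U''. \<forall>t\<in>S.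
        (U has_vector_derivative U' t) (at t within S) \<and>
        (U' has_vector_derivative U'' t) (at t within S) \<and>
        U'' t + \<beta> *\<^sub>R U' t = L (U t) + g t)"

lemma damped_wave_solution_on_subset:
  assumes "damped_wave_solution_on S \<beta> L g U" and "S' \<subseteq> S"
  shows "damped_wave_solution_on S' \<beta> L g U"
proof -
  obtain U' U'' where "\<forall>t\<in>S. (U has_vector_derivative U' t) (at t within S) \<and>
      (U' has_vector_derivative U'' t) (at t within S) \<and> U'' t + \<beta> *\<^sub>R U' t = L (U t) + g t"
    using assms(1) unfolding damped_wave_solution_on_def by blast
  with assms(2) show ?thesis
    unfolding damped_wave_solution_on_def
    by (intro exI[of _ U'] exI[of _ U''])
      (auto intro: has_vector_derivative_within_subset[OF _ assms(2)])
qed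

lemma damped_wave_solution_diff:
  assumes L: "linear L"
    and U: "damped_wave_solution_on S \<beta> L g U" and V: "damped_wave_solution_on S \<beta> L g V"
  shows "damped_wave_solution_on S \<beta> L (\<lambda>_. 0) (\<lambda>t. U t - V t)"
proof -
  obtain U' U'' where U: "\<And>t. t \<in> S \<Longrightarrow> (U has_vector_derivative U' t) (at t within S)"
     "\<And>t. t \<in> S \<Longrightarrow> (U' has_vector_derivative U'' t) (at t within S)"
     "\<And>t. t \<in> S \<Longrightarrow> U'' t + \<beta> *\<^sub>R U' t = L (U t) + g t"
    using U unfolding damped_wave_solution_on_def by metis
  obtain V' V'' where V: "\<And>t. t \<in> S \<Longrightarrow> (V has_vector_derivative V' t) (at t within S)"
     "\<And>t. t \<in> S \<Longrightarrow> (V' has_vector_derivative V'' t) (at t within S)"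
     "\<And>t. t \<in> S \<Longrightarrow> V'' t + \<beta> *\<^sub>R V' t = L (V t) + g t"
    using V unfolding damped_wave_solution_on_def by metis
  have "(U'' t - V'' t) + \<beta> *\<^sub>R (U' t - V' t) = L (U t - V t) + 0" if "t \<in> S" for t
    using U(3)[OF that] V(3)[OF that] by (simp add: linear_diff[OF L] algebra_simps)
  then show ?thesis
    unfolding damped_wave_solution_on_def using U(1,2) V(1,2)
    by (intro exI[of _ "\<lambda>t. U' t - V' t"] exI[of _ "\<lambda>t. U'' t - V'' t"])
      (auto intro!: has_vector_derivative_diff)
qed

lemma negative_definite_eigenmodes:
  fixes L :: "'a::euclidean_space \<Rightarrow> 'a"
  assumes L: "linear L" and sym: "\<And>x y. L x \<bullet> y = x \<bullet> L y"
    and neg: "\<And>x. x \<noteq> 0 \<Longrightarrow> x \<bullet> L x < 0"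
  obtains B l where "finite B" "\<And>b. b \<in> B \<Longrightarrow> l b > 0" "\<And>b. b \<in> B \<Longrightarrow> L b = - l b *\<^sub>R b"
    "\<And>x. (\<Sum>b\<in>B. (x \<bullet> b) *\<^sub>R b) = x"
proof -
  obtain B m where B: "finite B" "pairwise orthogonal B" "\<And>b. b \<in> B \<Longrightarrow> norm b = 1"
    "span B = UNIV" "\<And>b. b \<in> B \<Longrightarrow> L b = m b *\<^sub>R b"
    using self_adjoint_orthonormal_eigenbasis[OF L sym] by blast
  have "m b < 0" if "b \<in> B" for b
  proof -
    have "b \<noteq> 0" using B(3)[OF that] by auto
    with neg[OF this] B(3,5)[OF that] show ?thesis by (simp add: dot_square_norm)
  qed
  then show thesis
    using that[of B "\<lambda>b. - m b"] B orthonormal_basis_expand[OF B(2,3)] by auto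
qed

lemma damped_wave_decay:
  fixes L :: "'a::euclidean_space \<Rightarrow> 'a"
  assumes L: "linear L" and sym: "\<And>x y. L x \<bullet> y = x \<bullet> L y"
    and neg: "\<And>x. x \<noteq> 0 \<Longrightarrow> x \<bullet> L x < 0" and \<beta>: "\<beta> > 0"
    and D: "damped_wave_solution_on {t0..} \<beta> L (\<lambda>_. 0) D"
  shows "(D \<longlongrightarrow> 0) at_top"
proof -
  obtain B l where B: "finite B" "\<And>b. b \<in> B \<Longrightarrow> l b > 0" "\<And>b. b \<in> B \<Longrightarrow> L b = - l b *\<^sub>R b"
    "\<And>x. (\<Sum>b\<in>B. (x \<bullet> b) *\<^sub>R b) = x"
    using negative_definite_eigenmodes[OF L sym neg] by blast
  obtain D' D'' where D: "\<And>t. t \<ge> t0 \<Longrightarrow> (D has_vector_derivative D' t) (at t within {t0..})"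
     "\<And>t. t \<ge> t0 \<Longrightarrow> (D' has_vector_derivative D'' t) (at t within {t0..})"
     "\<And>t. t \<ge> t0 \<Longrightarrow> D'' t + \<beta> *\<^sub>R D' t = L (D t) + 0"
    using D unfolding damped_wave_solution_on_def by (metis atLeast_iff)
  have "((\<lambda>t. D t \<bullet> b) \<longlongrightarrow> 0) at_top" if b: "b \<in> B" for b
  proof (rule damped_oscillator_decay[OF \<beta> B(2)[OF b]])
    note inner = bounded_linear.has_vector_derivative[OF bounded_linear_inner_left]
    fix t assume t: "t \<ge> t0"
    show "((\<lambda>t. D t \<bullet> b) has_vector_derivative D' t \<bullet> b) (at t within {t0..})"
      using inner[OF D(1)[OF t]] .
    have "D'' t \<bullet> b = - \<beta> * (D' t \<bullet> b) - l b * (D t \<bullet> b)"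
    proof -
      have "D'' t = L (D t) - \<beta> *\<^sub>R D' t" using D(3)[OF t] by (simp add: algebra_simps)
      then show ?thesis by (simp add: inner_diff_left sym B(3)[OF b])
    qed
    then show "((\<lambda>t. D' t \<bullet> b) has_vector_derivative - \<beta> * (D' t \<bullet> b) - l b * (D t \<bullet> b))
        (at t within {t0..})"
      using inner[OF D(2)[OF t], of b] by simp
  qed
  then have "((\<lambda>t. \<Sum>b\<in>B. (D t \<bullet> b) *\<^sub>R b) \<longlongrightarrow> (\<Sum>b\<in>B. 0 *\<^sub>R b)) at_top"
    by (intro tendsto_intros)
  then show ?thesis by (simp add: B(4))
qed

lemma damped_wave_periodic_solution:
  fixes L :: "'a::euclidean_space \<Rightarrow> 'a"
  assumes L: "linear L" and sym: "\<And>x y. L x \<bullet> y = x \<bullet> L y"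
    and neg: "\<And>x. x \<noteq> 0 \<Longrightarrow> x \<bullet> L x < 0" and \<beta>: "\<beta> > 0" and T: "T > 0"
    and cont: "continuous_on UNIV g" and per: "\<And>t. g (t + T) = g t"
  obtains U where "damped_wave_solution_on UNIV \<beta> L g U" "\<And>t. U (t + T) = U t"
proof -
  obtain B l where B: "finite B" "\<And>b. b \<in> B \<Longrightarrow> l b > 0" "\<And>b. b \<in> B \<Longrightarrow> L b = - l b *\<^sub>R b"
    "\<And>x. (\<Sum>b\<in>B. (x \<bullet> b) *\<^sub>R b) = x"
    using negative_definite_eigenmodes[OF L sym neg] by blast
  have "\<exists>u v. (\<forall>t. (u has_vector_derivative v t) (at t)) \<and>
      (\<forall>t. (v has_vector_derivative g t \<bullet> b - \<beta> * v t - l b * u t) (at t)) \<and>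
      (\<forall>t. u (t + T) = u t)" if b: "b \<in> B" for b
  proof -
    have "continuous_on UNIV (\<lambda>t. g t \<bullet> b)"
      using cont by (intro continuous_intros)
    moreover have "g (t + T) \<bullet> b = g t \<bullet> b" for t by (simp add: per)
    ultimately obtain u v where "\<And>t. (u has_vector_derivative v t) (at t)"
      "\<And>t. (v has_vector_derivative g t \<bullet> b - \<beta> * v t - l b * u t) (at t)"
      "\<And>t. u (t + T) = u t"
      by (rule damped_oscillator_periodic_solution[OF \<beta> B(2)[OF b] T]) (rule that)
    then show ?thesis by (intro exI[of _ u] exI[of _ v]) simp
  qed
  then obtain u v where u: "\<And>b t. b \<in> B \<Longrightarrow> (u b has_vector_derivative v b t) (at t)"
      "\<And>b t. b \<in> B \<Longrightarrow> (v b has_vector_derivative g t \<bullet> b - \<beta> * v b t - l b * u b t) (at t)"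
      "\<And>b t. b \<in> B \<Longrightarrow> u b (t + T) = u b t"
    by metis
  define U where "U t = (\<Sum>b\<in>B. u b t *\<^sub>R b)" for t
  define U' where "U' t = (\<Sum>b\<in>B. v b t *\<^sub>R b)" for t
  define U'' where "U'' t = (\<Sum>b\<in>B. (g t \<bullet> b - \<beta> * v b t - l b * u b t) *\<^sub>R b)" for t
  note scale = bounded_linear.has_vector_derivative[OF bounded_linear_scaleR_left]
  have "(U has_vector_derivative U' t) (at t)" for t
    unfolding U_def U'_def by (intro has_vector_derivative_sum scale u)
  moreover have "(U' has_vector_derivative U'' t) (at t)" for t
    unfolding U'_def U''_def by (intro has_vector_derivative_sum scale u)
  moreover have "U'' t + \<beta> *\<^sub>R U' t = L (U t) + g t" for t
  proof -
    have "L (U t) = (\<Sum>b\<in>B. u b t *\<^sub>R L b)"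
      by (simp add: U_def linear_sum[OF L] linear_cmul[OF L])
    also have "\<dots> = (\<Sum>b\<in>B. - (l b * u b t) *\<^sub>R b)"
      by (intro sum.cong) (simp_all add: B(3) mult.commute)
    finally have "L (U t) + g t = (\<Sum>b\<in>B. - (l b * u b t) *\<^sub>R b) + (\<Sum>b\<in>B. (g t \<bullet> b) *\<^sub>R b)"
      by (simp add: B(4))
    then show ?thesis
      by (simp add: U''_def U'_def scaleR_sum_right scaleR_left_diff_distrib
          sum_subtractf sum_negf)
  qed
  ultimately have "damped_wave_solution_on UNIV \<beta> L g U"
    unfolding damped_wave_solution_on_def by (intro exI[of _ U'] exI[of _ U'']) simp
  moreover have "U (t + T) = U t" for t
    unfolding U_def by (intro sum.cong) (simp_all add: u(3))
  ultimately show thesis by (rule that)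
qed

lemma periodic_tendsto_zero_imp_zero:
  fixes D :: "real \<Rightarrow> 'a::real_normed_vector"
  assumes lim: "(D \<longlongrightarrow> 0) at_top" and T: "T > 0" and per: "\<And>t. D (t + T) = D t"
  shows "D t = 0"
proof -
  have shift: "D (t + real k * T) = D t" for k
  proof (induction k)
    case (Suc k)
    have "t + real (Suc k) * T = (t + real k * T) + T" by (simp add: algebra_simps)
    with Suc per show ?case by metis
  qed simp
  have "filterlim (\<lambda>k. t + real k * T) at_top sequentially"
    by (intro filterlim_tendsto_add_at_top[OF tendsto_const]
        filterlim_at_top_mult_tendsto_pos[OF tendsto_const T] filterlim_real_sequentially)
  from filterlim_compose[OF lim this] have "(\<lambda>k. D t) \<longlonglongrightarrow> 0"
    by (simp add: shift)
  then show ?thesis by (simp add: LIMSEQ_const_iff)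
qed

section \<open>The discrete Dirichlet Laplacian\<close>

lemma bij_betw_position:
  "bij_betw position (UNIV :: 'm::{finite,linorder} set) {..<CARD('m)}"
proof -
  have mono: "position i < position j" if "i < j" for i j :: 'm
    unfolding position_def using that by (intro psubset_card_mono) auto
  have "inj (position :: 'm \<Rightarrow> nat)"
    by (rule injI) (metis mono neq_iff)
  moreover have "position i < CARD('m)" for i :: 'm
    unfolding position_def by (intro psubset_card_mono) auto
  then have "range (position :: 'm \<Rightarrow> nat) \<subseteq> {..<CARD('m)}" by auto
  ultimately show ?thesis
    by (simp add: bij_betw_def card_image card_subset_eq)
qed

lemma matrix_mult_row:
  fixes A :: "real^'n^'m" and U :: "real^'p^'n"
  shows "(A ** U) $ i = (\<Sum>j\<in>UNIV. A $ i $ j *\<^sub>R U $ j)"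
  by (simp add: vec_eq_iff matrix_matrix_mult_def)

lemma symmetric_matrix_mult_inner:
  fixes A :: "real^'m^'m" and U V :: "real^'p^'m"
  assumes "transpose A = A"
  shows "(A ** U) \<bullet> V = U \<bullet> (A ** V)"
proof -
  have A: "A $ i $ j = A $ j $ i" for i j
    by (metis assms transpose_def vec_lambda_beta)
  have "(A ** U) \<bullet> V = (\<Sum>i\<in>UNIV. \<Sum>j\<in>UNIV. A $ i $ j * (U $ j \<bullet> V $ i))"
    by (simp add: inner_vec_def[of _ V] matrix_mult_row inner_sum_left)
  also have "\<dots> = (\<Sum>j\<in>UNIV. \<Sum>i\<in>UNIV. A $ i $ j * (U $ j \<bullet> V $ i))"
    by (rule sum.swap)
  also have "\<dots> = (\<Sum>j\<in>UNIV. \<Sum>i\<in>UNIV. A $ j $ i * (U $ j \<bullet> V $ i))"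
    by (subst A) simp
  also have "\<dots> = U \<bullet> (A ** V)"
    by (simp add: inner_vec_def[of U] matrix_mult_row inner_sum_right)
  finally show ?thesis .
qed

text \<open>
  Summation by parts, keeping the boundary term at the right end so that the identity can be proved
  by induction on \<open>n\<close>. The boundary term at the left end vanishes because \<open>X 0 = 0\<close>.
\<close>

lemma sum_second_difference_by_parts:
  fixes X :: "nat \<Rightarrow> 'a::real_inner"
  assumes "X 0 = 0"
  shows "(\<Sum>k<n. X (Suc k) \<bullet> (X k - 2 *\<^sub>R X (Suc k) + X (Suc (Suc k)))) =
    X n \<bullet> (X (Suc n) - X n) - (\<Sum>k<n. (norm (X (Suc k) - X k))\<^sup>2)"
proof (induction n)
  case (Suc n)
  then show ?case
    by (simp add: power2_norm_eq_inner inner_commute algebra_simps)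
qed (simp add: assms)

text \<open>
  Pad the rows of \<open>U\<close> with a zero row at both ends. Every row of \<open>A U\<close>, including the first and
  the last, is then a second difference, and summation by parts turns \<open>U \<bullet> A U\<close> into minus the
  sum of the squared increments of the padded sequence. If this sum vanishes, the padded sequence is
  constant and starts at zero, so \<open>U = 0\<close>.
\<close>

lemma discrete_Laplacian_negative_definite:
  fixes U :: "real^'p^('m::{finite,linorder})"
  assumes "U \<noteq> 0"
  shows "U \<bullet> (tridiag 1 (-2) 1 ** U) < 0"
proof -
  \<comment> \<open>The padded sequence: \<open>X 0\<close> and \<open>X (CARD('m) + 1)\<close> are empty sums, and row \<open>i\<close> of
    \<open>U\<close> is \<open>X (position i + 1)\<close>.\<close>
  define X where "X k = (\<Sum>j\<in>{j. Suc (position j) = k}. U $ j)" for k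
  let ?N = "CARD('m)"
  have inj: "position i = position j \<longleftrightarrow> i = j" for i j :: 'm
    using bij_betw_imp_inj_on[OF bij_betw_position] by (auto dest: injD)
  have less: "position i < ?N" for i :: 'm
    using bij_betwE[OF bij_betw_position] by auto
  have X0: "X 0 = 0" by (simp add: X_def)
  have XN: "X (Suc ?N) = 0"
    using less by (auto simp: X_def less_le intro!: sum.neutral)
  have XU: "X (Suc (position i)) = U $ i" for i
    by (simp add: X_def inj)
  have row: "(tridiag 1 (-2) 1 ** U) $ i
      = X (position i) - 2 *\<^sub>R X (Suc (position i)) + X (Suc (Suc (position i)))" for i
  proof -
    have coeff: "(tridiag 1 (-2) 1 :: real^('m::{finite,linorder})^('m::{finite,linorder})) $ i $ j = of_bool (Suc (position j) = position i)
        - 2 * of_bool (position j = position i) + of_bool (position j = Suc (position i))" for j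
      by (auto simp: tridiag_def)
    have "(tridiag 1 (-2) 1 ** U) $ i = (\<Sum>j\<in>UNIV. (tridiag 1 (-2) 1 :: real^('m::{finite,linorder})^('m::{finite,linorder})) $ i $ j *\<^sub>R U $ j)"
      by (rule matrix_mult_row)
    also have "\<dots> = (\<Sum>j\<in>UNIV. of_bool (Suc (position j) = position i) *\<^sub>R U $ j)
        - 2 *\<^sub>R (\<Sum>j\<in>UNIV. of_bool (position j = position i) *\<^sub>R U $ j)
        + (\<Sum>j\<in>UNIV. of_bool (position j = Suc (position i)) *\<^sub>R U $ j)"
      by (simp add: coeff scaleR_left_distrib scaleR_left_diff_distrib sum.distrib sum_subtractf
          scaleR_sum_right)
    also have "\<dots> = X (position i) - 2 *\<^sub>R X (Suc (position i)) + X (Suc (Suc (position i)))"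
      by (simp add: X_def of_bool_def if_distrib[of "\<lambda>c. c *\<^sub>R _"] sum.If_cases cong: if_cong)
    finally show ?thesis .
  qed
  have "U \<bullet> (tridiag 1 (-2) 1 ** U) = (\<Sum>i\<in>(UNIV :: 'm set). X (Suc (position i)) \<bullet>
      (X (position i) - 2 *\<^sub>R X (Suc (position i)) + X (Suc (Suc (position i)))))"
    by (simp add: inner_vec_def[of U] row XU)
  also have "\<dots> = (\<Sum>k<?N. X (Suc k) \<bullet> (X k - 2 *\<^sub>R X (Suc k) + X (Suc (Suc k))))"
    by (rule sum.reindex_bij_betw[OF bij_betw_position])
  also have "\<dots> = X ?N \<bullet> (X (Suc ?N) - X ?N) - (\<Sum>k<?N. (norm (X (Suc k) - X k))\<^sup>2)"
    by (rule sum_second_difference_by_parts[where X = X, OF X0])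
  also have "\<dots> \<le> - (\<Sum>k<?N. (norm (X (Suc k) - X k))\<^sup>2)"
    by (simp add: XN)
  finally have le: "U \<bullet> (tridiag 1 (-2) 1 ** U) \<le> - (\<Sum>k<?N. (norm (X (Suc k) - X k))\<^sup>2)" .
  have "(\<Sum>k<?N. (norm (X (Suc k) - X k))\<^sup>2) \<noteq> 0"
  proof
    assume "(\<Sum>k<?N. (norm (X (Suc k) - X k))\<^sup>2) = 0"
    then have step: "X (Suc k) = X k" if "k < ?N" for k
      using that by (simp add: sum_nonneg_eq_0_iff)
    have "X k = 0" if "k \<le> ?N" for k
      using that by (induction k) (auto simp: X0 step)
    then have "U $ i = 0" for i
      using less[of i] by (simp flip: XU)
    with assms show False by (simp add: vec_eq_iff)
  qed
  moreover have "(\<Sum>k<?N. (norm (X (Suc k) - X k))\<^sup>2) \<ge> 0"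
    by (intro sum_nonneg) simp
  ultimately show ?thesis using le by linarith
qed

section \<open>Periodic forcing of the hyperbolic curvature flow\<close>

lemma continuous_on_axis:
  fixes f :: "'a::topological_space \<Rightarrow> 'b::real_normed_vector"
  assumes "continuous_on S f"
  shows "continuous_on S (\<lambda>t. axis i (f t) :: 'b^'n)"
  unfolding axis_def
proof (intro continuous_on_vec_lambda)
  show "continuous_on S (\<lambda>t. if j = i then f t else 0)" for j :: 'n
    by (cases "j = i") (use assms in auto)
qed

theorem proposition8:
  fixes n p :: nat
    and \<beta> T :: real
    and f1 fn :: "real \<Rightarrow> real^'p"
  assumes "n \<ge> 4" and "p \<ge> 2"
    and "CARD('m::{finite,linorder}) = n - 2" and "CARD('p) = p"
    and "\<beta> > 0" and "T > 0"
    and "continuous_on UNIV f1" and "continuous_on UNIV fn"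
    and "\<And>t. f1 (t + T) = f1 t" and "\<And>t. fn (t + T) = fn t"
  shows "(\<exists>!U :: real \<Rightarrow> real^'p^('m::{finite,linorder}).
            hcf_solution_on UNIV \<beta> f1 fn U \<and> (\<forall>t. U (t + T) = U t)) \<and>
         (\<forall>U :: real \<Rightarrow> real^'p^('m::{finite,linorder}).
            hcf_solution_on UNIV \<beta> f1 fn U \<and> (\<forall>t. U (t + T) = U t) \<longrightarrow>
            (\<forall>t0. \<forall>V :: real \<Rightarrow> real^'p^('m::{finite,linorder}). hcf_solution_on {t0..} \<beta> f1 fn V \<longrightarrow>
               ((\<lambda>t. norm (V t - U t)) \<longlongrightarrow> 0) at_top))"
proof -
  let ?L = "\<lambda>U :: real^'p^('m::{finite,linorder}). tridiag 1 (-2) 1 ** U"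
  let ?g = "\<lambda>t. boundary_forcing (f1 t) (fn t) :: real^'p^('m::{finite,linorder})"
  have sol_eq: "hcf_solution_on S \<beta> f1 fn = damped_wave_solution_on S \<beta> ?L ?g" for S
    by (intro ext) (simp add: hcf_solution_on_def damped_wave_solution_on_def)
  have L: "linear ?L"
    by (intro linearI) (simp_all add: vec_eq_iff matrix_matrix_mult_def sum.distrib distrib_left
        sum_distrib_left mult_ac)
  have "transpose (tridiag 1 (-2) 1 :: real^('m::{finite,linorder})^('m::{finite,linorder})) = tridiag 1 (-2) 1"
    by (auto simp: transpose_def tridiag_def vec_eq_iff)
  then have sym: "?L U \<bullet> V = U \<bullet> ?L V" for U V :: "real^'p^('m::{finite,linorder})"
    by (rule symmetric_matrix_mult_inner)
  have neg: "U \<bullet> ?L U < 0" if "U \<noteq> 0" for U :: "real^'p^('m::{finite,linorder})"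
    using that by (rule discrete_Laplacian_negative_definite)
  have cont: "continuous_on UNIV ?g"
    unfolding boundary_forcing_def using assms(7,8) by (intro continuous_on_add continuous_on_axis)
  have per: "?g (t + T) = ?g t" for t
    by (simp add: assms(9,10))
  obtain U0 :: "real \<Rightarrow> real^'p^('m::{finite,linorder})"
    where "damped_wave_solution_on UNIV \<beta> ?L ?g U0" and U0_per: "\<And>t. U0 (t + T) = U0 t"
    by (rule damped_wave_periodic_solution[OF L _ _ \<open>\<beta> > 0\<close> \<open>T > 0\<close> cont])
      (rule sym, erule neg, rule per, rule that)
  then have U0: "hcf_solution_on UNIV \<beta> f1 fn U0" by (simp only: sol_eq)
  have stable: "((\<lambda>t. V t - U t) \<longlongrightarrow> 0) at_top"
    if U: "hcf_solution_on UNIV \<beta> f1 fn U" and V: "hcf_solution_on {t0..} \<beta> f1 fn V"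
    for t0 and U V :: "real \<Rightarrow> real^'p^('m::{finite,linorder})"
  proof (rule damped_wave_decay[OF L sym neg \<open>\<beta> > 0\<close>])
    have "damped_wave_solution_on {t0..} \<beta> ?L ?g U"
      using U unfolding sol_eq by (rule damped_wave_solution_on_subset) simp
    with V show "damped_wave_solution_on {t0..} \<beta> ?L (\<lambda>_. 0) (\<lambda>t. V t - U t)"
      unfolding sol_eq by (intro damped_wave_solution_diff[OF L])
  qed
  have unique: "V = U"
    if U: "hcf_solution_on UNIV \<beta> f1 fn U" "\<And>t. U (t + T) = U t"
      and V: "hcf_solution_on UNIV \<beta> f1 fn V" "\<And>t. V (t + T) = V t"
    for U V :: "real \<Rightarrow> real^'p^('m::{finite,linorder})"
  proof
    fix t
    have "hcf_solution_on {0..} \<beta> f1 fn V"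
      using V(1) unfolding sol_eq by (rule damped_wave_solution_on_subset) simp
    from stable[OF U(1) this] have "V t - U t = 0"
      by (rule periodic_tendsto_zero_imp_zero[OF _ \<open>T > 0\<close>]) (simp add: U(2) V(2))
    then show "V t = U t" by simp
  qed
  show ?thesis
  proof (intro conjI allI impI)
    show "\<exists>!U :: real \<Rightarrow> real^'p^('m::{finite,linorder}).
        hcf_solution_on UNIV \<beta> f1 fn U \<and> (\<forall>t. U (t + T) = U t)"
    proof (rule ex1I)
      show "hcf_solution_on UNIV \<beta> f1 fn U0 \<and> (\<forall>t. U0 (t + T) = U0 t)"
        using U0 U0_per by simp
    next
      fix V :: "real \<Rightarrow> real^'p^('m::{finite,linorder})"
      assume V: "hcf_solution_on UNIV \<beta> f1 fn V \<and> (\<forall>t. V (t + T) = V t)"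
      show "V = U0"
        by (rule unique[OF U0 U0_per]) (simp_all only: V)
    qed
  next
    fix U V :: "real \<Rightarrow> real^'p^('m::{finite,linorder})" and t0
    assume "hcf_solution_on UNIV \<beta> f1 fn U \<and> (\<forall>t. U (t + T) = U t)"
      and V: "hcf_solution_on {t0..} \<beta> f1 fn V"
    then have "hcf_solution_on UNIV \<beta> f1 fn U" by simp
    from stable[OF this V] show "((\<lambda>t. norm (V t - U t)) \<longlongrightarrow> 0) at_top"
      by (rule tendsto_norm_zero)
  qed
qed

end
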